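(* For any positive integer $k$, the number of EVEN colored compositions of $k+1$ is equal to $$\sum_{w\in\{0,1\}^k}\ \prod_{r} |r|,$$ where for each binary string $w$ of length $k$ the product is over all runs $r$ of $1$'s in $w$ and $|r|$ denotes the length of the run $r$.
   Context: A composition of a positive integer $k$ is a finite ordered sequence of positive integers (called parts) whose sum is $k$; positions of parts are numbered $1,2,3,\dots$ from left to right. An EVEN colored composition of $k$ is a composition of $k$ in which each part in an even position (2nd, 4th, ...) of size $p$ is given one of $p$ colors $1,\dots,p$, while the parts in odd positions are not colored. A run of $1$'s in a binary string is a maximal nonempty contiguous block of $1$'s. If a string has no $1$'s, the (empty) product is $1$. *)

theory Defs
  imports Main
begin

definition compositions :: "nat \<Rightarrow> nat list set" where
  "compositions n = {ps. (\<forall>p \<in> set ps. p \<ge> 1) \<and> sum_list ps = n}"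

text \<open>
  Each entry of the list is a part together with its color, \<open>None\<close> meaning that the part is
  not colored. List indices start at 0, so index \<open>i\<close> is position \<open>i + 1\<close> of the composition.
\<close>

definition even_colored_compositions :: "nat \<Rightarrow> (nat \<times> nat option) list set" where
  "even_colored_compositions n =
     {xs. map fst xs \<in> compositions n \<and>
          (\<forall>i < length xs.
             if even (i + 1) then \<exists>c \<in> {1..fst (xs ! i)}. snd (xs ! i) = Some c
             else snd (xs ! i) = None)}"

definition binary_strings :: "nat \<Rightarrow> nat list set" where
  "binary_strings k = {w. set w \<subseteq> {0, 1} \<and> length w = k}"

text \<open>Blocks and runs are represented by their sets of indices, so the length of a run is its
  cardinality and runs of equal length at different places are distinct.\<close>

definition one_blocks :: "nat list \<Rightarrow> nat set set" where
  "one_blocks w = {{i..<j} | i j. i < j \<and> j \<le> length w \<and> (\<forall>m \<in> {i..<j}. w ! m = 1)}"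

definition one_runs :: "nat list \<Rightarrow> nat set set" where
  "one_runs w = {r \<in> one_blocks w. \<forall>b \<in> one_blocks w. r \<subseteq> b \<longrightarrow> b = r}"

end

theory Submission imports Defs begin

text \<open>
  Let \<open>E n\<close> count the compositions of \<open>n\<close> coloured in even positions, \<open>O n\<close> those coloured in
  odd positions, and let \<open>V a k\<close> be the sum of the run products of the strings \<open>1\<^sup>aw\<close> with
  \<open>w \<in> {0,1}\<^sup>k\<close>. Removing the first part gives \<open>E (n + 2) = E (n + 1) + O (n + 1)\<close> and
  \<open>O (n + 2) = O (n + 1) + S (n + 1)\<close> with \<open>S n = E 0 + \<dots> + E n\<close>, whereas reading the first letter
  of \<open>w\<close> gives \<open>V a (k + 1) = max a 1 * V 0 k + V (a + 1) k\<close>. By induction on \<open>k\<close>,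
  \<open>V 0 k = E (k + 1)\<close> and \<open>V (a + 1) k = O (k + 1) + a * S k\<close>.
\<close>

section \<open>Runs of ones\<close>

lemma one_blocksI:
  "\<lbrakk>i < j; j \<le> length w; \<And>m. m \<in> {i..<j} \<Longrightarrow> w ! m = 1\<rbrakk> \<Longrightarrow> {i..<j} \<in> one_blocks w"
  unfolding one_blocks_def by blast

text \<open>A block strictly containing \<open>{i..<j}\<close> must contain index
  \<open>i - 1\<close> or index \<open>j\<close>, so maximality can be tested on the two
  neighbouring letters. The later arguments use only this local criterion.\<close>

lemma one_runs_iff:
  "r \<in> one_runs w \<longleftrightarrow>
     (\<exists>i j. r = {i..<j} \<and> i < j \<and> j \<le> length w \<and> (\<forall>m\<in>{i..<j}. w ! m = 1) \<and>
            (i > 0 \<longrightarrow> w ! (i - 1) \<noteq> 1) \<and> (j < length w \<longrightarrow> w ! j \<noteq> 1))" (is "?L \<longleftrightarrow> ?R")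
proof
  assume L: ?L
  then obtain i j where r: "r = {i..<j}" "i < j" "j \<le> length w" "\<forall>m\<in>{i..<j}. w ! m = 1"
    by (auto simp: one_runs_def one_blocks_def)
  have max: "b = r" if "b \<in> one_blocks w" "r \<subseteq> b" for b
    using L that by (auto simp: one_runs_def)
  have "w ! (i - 1) \<noteq> 1" if "i > 0"
  proof
    assume 1: "w ! (i - 1) = 1"
    \<comment> \<open>A neighbouring 1 would extend the block by one index, against
      maximality.\<close>
    have "w ! m = 1" if "m \<in> {i - 1..<j}" for m
      using that r(4) 1 by (cases "m = i - 1") auto
    then have "{i - 1..<j} \<in> one_blocks w"
      by (rule one_blocksI[rotated 2]) (use r in auto)
    from max[OF this] have "{i - 1..<j} = {i..<j}" using r by auto
    moreover have "i - 1 \<in> {i - 1..<j}" "i - 1 \<notin> {i..<j}" using \<open>i > 0\<close> r by auto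
    ultimately show False by simp
  qed
  moreover have "w ! j \<noteq> 1" if "j < length w"
  proof
    assume 1: "w ! j = 1"
    have "w ! m = 1" if "m \<in> {i..<Suc j}" for m
      using that r(4) 1 by (cases "m = j") auto
    then have "{i..<Suc j} \<in> one_blocks w"
      by (rule one_blocksI[rotated 2]) (use r that in auto)
    from max[OF this] have "{i..<Suc j} = {i..<j}" using r by auto
    moreover have "j \<in> {i..<Suc j}" "j \<notin> {i..<j}" using r by auto
    ultimately show False by simp
  qed
  ultimately show ?R using r by blast
next
  assume ?R
  then obtain i j where r: "r = {i..<j}" "i < j" "j \<le> length w" "\<forall>m\<in>{i..<j}. w ! m = 1"
    and l: "i > 0 \<longrightarrow> w ! (i - 1) \<noteq> 1" and u: "j < length w \<longrightarrow> w ! j \<noteq> 1" by blast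
  have "b = r" if b: "b \<in> one_blocks w" "r \<subseteq> b" for b
  proof -
    obtain i' j' where b': "b = {i'..<j'}" "j' \<le> length w" "\<forall>m\<in>{i'..<j'}. w ! m = 1"
      using b by (auto simp: one_blocks_def)
    have le: "i' \<le> i" "j \<le> j'"
      using b(2) r(1,2) b'(1) by (simp_all add: ivl_subset)
    have "\<not> i' < i"
    proof
      assume "i' < i"
      then have "i - 1 \<in> {i'..<j'}" "i > 0" using le r(2) by auto
      then show False using l b'(3) by blast
    qed
    moreover have "\<not> j < j'"
    proof
      assume "j < j'"
      then have "j \<in> {i'..<j'}" "j < length w" using le r(2) b'(2) by auto
      then show False using u b'(3) by blast
    qed
    ultimately show ?thesis using le r(1) b'(1) by simp
  qed
  moreover have "r \<in> one_blocks w" using r by (auto simp: one_blocks_def)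
  ultimately show ?L by (simp add: one_runs_def)
qed

lemma one_runsI:
  assumes "i < j" "j \<le> length w" "\<And>m. m \<in> {i..<j} \<Longrightarrow> w ! m = 1"
    "i > 0 \<Longrightarrow> w ! (i - 1) \<noteq> 1" "j < length w \<Longrightarrow> w ! j \<noteq> 1"
  shows "{i..<j} \<in> one_runs w"
  using assms unfolding one_runs_iff by blast

lemma one_runs_subset: "r \<in> one_runs w \<Longrightarrow> r \<subseteq> {..<length w}"
  by (auto simp: one_runs_iff)

lemma finite_one_runs: "finite (one_runs w)"
  by (rule finite_subset[of _ "Pow {..<length w}"]) (use one_runs_subset in auto)

lemma empty_notin_one_runs: "{} \<notin> one_runs w"
  by (auto simp: one_runs_iff)

lemma one_runs_replicate: "one_runs (replicate a 1) = (if a = 0 then {} else {{0..<a}})"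
proof (intro set_eqI iffI)
  fix r assume "r \<in> one_runs (replicate a 1)"
  then obtain i j where "r = {i..<j}" "i < j" "j \<le> a"
    "i > 0 \<longrightarrow> replicate a (1::nat) ! (i - 1) \<noteq> 1" "j < a \<longrightarrow> replicate a (1::nat) ! j \<noteq> 1"
    by (auto simp: one_runs_iff)
  then have "i = 0" "j = a" "a > 0" by (cases "i = 0"; cases "j < a"; simp)+
  then show "r \<in> (if a = 0 then {} else {{0..<a}})" using \<open>r = {i..<j}\<close> by simp
next
  fix r assume "r \<in> (if a = 0 then {} else {{0..<a}})"
  then have "r = {0..<a}" "a > 0" by (auto split: if_splits)
  then show "r \<in> one_runs (replicate a 1)" by (auto intro: one_runsI)
qed

text \<open>The separator \<open>x\<close> is not a 1, so no run crosses it, and at the inner ends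
  it serves as the neighbour that stops a run. Runs of \<open>v\<close> reappear shifted past
  \<open>u\<close> and \<open>x\<close>.\<close>

lemma one_runs_append:
  assumes x: "x \<noteq> 1"
  shows "one_runs (u @ x # v) = one_runs u \<union> (\<lambda>r. (+) (Suc (length u)) ` r) ` one_runs v"
    (is "?L = _ \<union> ?f ` _")
proof (intro set_eqI iffI)
  let ?n = "Suc (length u)"
  fix r assume "r \<in> ?L"
  then obtain i j where r: "r = {i..<j}" "i < j" "j \<le> length (u @ x # v)"
    "\<forall>m\<in>{i..<j}. (u @ x # v) ! m = 1" "i > 0 \<longrightarrow> (u @ x # v) ! (i - 1) \<noteq> 1"
    "j < length (u @ x # v) \<longrightarrow> (u @ x # v) ! j \<noteq> 1"
    unfolding one_runs_iff by blast
  \<comment> \<open>Index \<open>length u\<close> holds \<open>x\<close>, so the interval of ones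
    lies entirely on one side of it.\<close>
  have "length u \<notin> {i..<j}" using r(4) x by (metis nth_append_length)
  then consider "j \<le> length u" | "?n \<le> i" by fastforce
  then show "r \<in> one_runs u \<union> ?f ` one_runs v"
  proof cases
    case 1
    have "u ! m = 1" if "m \<in> {i..<j}" for m
      using r(4) that 1 by (force simp: nth_append)
    moreover have "i - 1 < length u" using r(2) 1 by simp
    then have "i > 0 \<longrightarrow> u ! (i - 1) \<noteq> 1" using r(5) by (simp add: nth_append)
    moreover have "j < length u \<longrightarrow> u ! j \<noteq> 1" using r(6) by (auto simp: nth_append)
    ultimately have "r \<in> one_runs u"
      using r(1,2) 1 by (auto intro: one_runsI)
    then show ?thesis by simp
  next
    case 2
    define i' j' where "i' = i - ?n" and "j' = j - ?n"
    have ij: "i = ?n + i'" "j = ?n + j'" using 2 r(2) by (auto simp: i'_def j'_def)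
    have nth: "(u @ x # v) ! (?n + m) = v ! m" for m by (simp add: nth_append)
    have ones: "v ! m = 1" if "m \<in> {i'..<j'}" for m
      using r(4) that nth[of m] unfolding ij by fastforce
    have low: "v ! (i' - 1) \<noteq> 1" if "i' > 0"
    proof -
      have "i - 1 = ?n + (i' - 1)" using that ij by simp
      then show ?thesis using r(5) nth[of "i' - 1"] ij by fastforce
    qed
    have up: "v ! j' \<noteq> 1" if "j' < length v"
      using r(6) nth[of j'] that unfolding ij by simp
    have "{i'..<j'} \<in> one_runs v"
      using r(2,3) ij ones low up by (intro one_runsI) simp_all
    moreover have "r = ?f {i'..<j'}" unfolding r(1) ij by (simp only: image_add_atLeastLessThan add.commute)
    ultimately show ?thesis by blast
  qed
next
  let ?n = "Suc (length u)"
  fix r assume "r \<in> one_runs u \<union> ?f ` one_runs v"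
  then show "r \<in> ?L"
  proof
    assume "r \<in> one_runs u"
    then obtain i j where r: "r = {i..<j}" "i < j" "j \<le> length u"
      "\<forall>m\<in>{i..<j}. u ! m = 1" "i > 0 \<longrightarrow> u ! (i - 1) \<noteq> 1" "j < length u \<longrightarrow> u ! j \<noteq> 1"
      unfolding one_runs_iff by blast
    have "(u @ x # v) ! m = 1" if "m \<in> {i..<j}" for m
      using r(3,4) that by (simp add: nth_append)
    moreover have "i - 1 < length u" using r(2,3) by simp
    then have "i > 0 \<longrightarrow> (u @ x # v) ! (i - 1) \<noteq> 1" using r(5) by (simp add: nth_append)
    \<comment> \<open>A run ending at the end of \<open>u\<close> now has \<open>x\<close> as its
      right neighbour.\<close>
    moreover have "(u @ x # v) ! j \<noteq> 1" using r(3,6) x by (cases "j = length u") (auto simp: nth_append)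
    moreover have "j \<le> length (u @ x # v)" using r(3) by simp
    ultimately show ?thesis
      using r(1,2) by (auto intro: one_runsI)
  next
    assume "r \<in> ?f ` one_runs v"
    then obtain s where s: "r = ?f s" "s \<in> one_runs v" by blast
    from s(2) obtain i j where r: "s = {i..<j}" "i < j" "j \<le> length v"
      "\<forall>m\<in>{i..<j}. v ! m = 1" "i > 0 \<longrightarrow> v ! (i - 1) \<noteq> 1" "j < length v \<longrightarrow> v ! j \<noteq> 1"
      unfolding one_runs_iff by blast
    have "r = {?n + i..<?n + j}" unfolding s(1) r(1) by (simp only: image_add_atLeastLessThan add.commute)
    moreover have "(u @ x # v) ! m = 1" if "m \<in> {?n + i..<?n + j}" for m
    proof -
      have "m - ?n \<in> {i..<j}" "m = ?n + (m - ?n)" using that by auto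
      moreover have "(u @ x # v) ! (?n + (m - ?n)) = v ! (m - ?n)" by (simp add: nth_append)
      ultimately show ?thesis using r(4) by metis
    qed
    \<comment> \<open>For \<open>i = 0\<close> the left neighbour is \<open>x\<close>; otherwise it
      is a letter of \<open>v\<close>.\<close>
    moreover have "(u @ x # v) ! (?n + i - 1) \<noteq> 1"
      using r(5) x by (cases i) (auto simp: nth_append)
    moreover have "(u @ x # v) ! (?n + j) \<noteq> 1" if "?n + j < length (u @ x # v)"
      using r(6) that by (auto simp: nth_append)
    ultimately show ?thesis
      using r(2,3) one_runsI[of "?n + i" "?n + j" "u @ x # v"] by simp
  qed
qed

text \<open>The two families of runs are disjoint, and the shift is injective and preserves
  cardinalities, so the product factors.\<close>

lemma prod_card_one_runs_append:
  assumes "x \<noteq> 1"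
  shows "(\<Prod>r\<in>one_runs (u @ x # v). card r) =
    (\<Prod>r\<in>one_runs u. card r) * (\<Prod>r\<in>one_runs v. card r)"
proof -
  let ?f = "\<lambda>r. (+) (Suc (length u)) ` r"
  have "one_runs u \<inter> ?f ` one_runs v = {}"
  proof (rule ccontr)
    assume "one_runs u \<inter> ?f ` one_runs v \<noteq> {}"
    then obtain r s where rs: "r \<in> one_runs u" "s \<in> one_runs v" "r = ?f s" by blast
    \<comment> \<open>The shift fixes the empty set, so disjointness depends on runs being
      nonempty.\<close>
    have "s \<noteq> {}" using rs(2) empty_notin_one_runs by metis
    then obtain m where "m \<in> s" by blast
    then have "Suc (length u) + m \<in> r" using rs(3) by blast
    then show False using one_runs_subset[OF rs(1)] by auto
  qed
  moreover have "inj_on ?f (one_runs v)"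
    by (rule inj_onI) (simp only: inj_image_eq_iff[OF inj_on_add])
  ultimately show ?thesis
    by (simp only: one_runs_append[OF assms] prod.union_disjoint finite_one_runs finite_imageI
        prod.reindex o_def card_image[OF inj_on_add])
qed

section \<open>Sums of run products\<close>

text \<open>The \<open>a\<close> prefixed ones record the length of the run still open when
  \<open>w\<close> is read from left to right; this generalization makes a recursion
  possible.\<close>

definition run_sum :: "nat \<Rightarrow> nat \<Rightarrow> nat" where
  "run_sum a k = (\<Sum>w\<in>binary_strings k. \<Prod>r\<in>one_runs (replicate a 1 @ w). card r)"

lemma finite_binary_strings: "finite (binary_strings k)"
  unfolding binary_strings_def by (rule finite_lists_length_eq) simp

lemma binary_strings_Suc:
  "binary_strings (Suc k) = (#) 0 ` binary_strings k \<union> (#) 1 ` binary_strings k"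
  by (auto simp: binary_strings_def length_Suc_conv)

lemma prod_card_one_runs_replicate: "(\<Prod>r\<in>one_runs (replicate a 1). card r) = max a 1"
  unfolding one_runs_replicate by simp

lemma run_sum_0: "run_sum a 0 = max a 1"
proof -
  have "binary_strings 0 = {[]}" by (auto simp: binary_strings_def)
  then show ?thesis using prod_card_one_runs_replicate by (simp add: run_sum_def)
qed

text \<open>A first letter 0 closes the open run, which contributes its length, or the empty product
  1 if \<open>a = 0\<close>; a first letter 1 lengthens it.\<close>

lemma run_sum_Suc: "run_sum a (Suc k) = max a 1 * run_sum 0 k + run_sum (Suc a) k"
proof -
  have one: "replicate a (1::nat) @ 1 # w = replicate (Suc a) 1 @ w" for w
    by (simp add: replicate_app_Cons_same)
  have "run_sum a (Suc k) =
      (\<Sum>w\<in>binary_strings k. \<Prod>r\<in>one_runs (replicate a 1 @ 0 # w). card r) +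
      (\<Sum>w\<in>binary_strings k. \<Prod>r\<in>one_runs (replicate a 1 @ 1 # w). card r)"
    unfolding run_sum_def binary_strings_Suc
    by (subst sum.union_disjoint) (auto simp: finite_binary_strings sum.reindex)
  then show ?thesis
    unfolding one
    by (simp only: prod_card_one_runs_append[OF zero_neq_one] prod_card_one_runs_replicate
        run_sum_def sum_distrib_left replicate_0 append_Nil)
qed

section \<open>Compositions with alternately coloured parts\<close>

fun colors :: "bool \<Rightarrow> nat \<Rightarrow> nat option set" where
  "colors True p = Some ` {1..p}"
| "colors False p = {None}"

lemma card_colors: "card (colors b p) = (if b then p else 1)"
  by (cases b) (simp_all add: card_image)

lemma finite_colors: "finite (colors b p)"
  by (cases b) simp_all

text \<open>The flag tells whether the first part is coloured.\<close>

fun colored :: "bool \<Rightarrow> (nat \<times> nat option) list \<Rightarrow> bool" where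
  "colored b [] = True"
| "colored b (x # xs) = (fst x \<ge> 1 \<and> snd x \<in> colors b (fst x) \<and> colored (\<not> b) xs)"

definition colored_compositions :: "bool \<Rightarrow> nat \<Rightarrow> (nat \<times> nat option) list set" where
  "colored_compositions b n = {xs. colored b xs \<and> sum_list (map fst xs) = n}"

text \<open>The flag flips at each part, so at index \<open>i\<close> it equals \<open>b\<close>
  exactly when \<open>i\<close> is even, that is, it is \<open>odd i \<noteq> b\<close>.\<close>

lemma colored_iff:
  "colored b xs \<longleftrightarrow> (\<forall>p\<in>set (map fst xs). p \<ge> 1) \<and>
     (\<forall>i<length xs. snd (xs ! i) \<in> colors (odd i \<noteq> b) (fst (xs ! i)))"
proof (induction xs arbitrary: b)
  case (Cons x xs)
  have "(odd (Suc i) \<noteq> b) = (odd i \<noteq> (\<not> b))" for i by auto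
  moreover have "(odd (0::nat) \<noteq> b) = b" by simp
  ultimately show ?case
    by (simp only: colored.simps Cons list.map list.set length_Cons All_less_Suc2 nth_Cons_0
        nth_Cons_Suc ball_simps) blast
qed simp

lemma even_colored_compositions_eq: "even_colored_compositions n = colored_compositions False n"
proof -
  have "(if even (i + 1) then \<exists>c\<in>{1..p}. y = Some c else y = None) \<longleftrightarrow> y \<in> colors (odd i) p"
    for i p :: nat and y
    by auto
  then show ?thesis
    unfolding even_colored_compositions_def compositions_def colored_compositions_def colored_iff
    by auto
qed

lemma colored_compositions_0: "colored_compositions b 0 = {[]}"
proof -
  have "xs = []" if "colored b xs" "sum_list (map fst xs) = 0" for xs
    using that by (cases xs) auto
  then show ?thesis by (auto simp: colored_compositions_def)
qed

text \<open>Split off the first part. The index \<open>i\<close> is the sum of the remaining parts,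
  so \<open>i \<le> n\<close> says that the first part is positive; the rest starts with the
  opposite flag.\<close>

lemma colored_compositions_Suc:
  "colored_compositions b (Suc n) =
     (\<lambda>(i, c, xs). (Suc n - i, c) # xs) `
       (SIGMA i:{..n}. colors b (Suc n - i) \<times> colored_compositions (\<not> b) i)" (is "?L = ?f ` ?S")
proof (intro set_eqI iffI)
  fix ys assume ys: "ys \<in> ?L"
  then obtain p c xs where eq: "ys = (p, c) # xs"
    by (cases ys) (auto simp: colored_compositions_def)
  define i where "i = sum_list (map fst xs)"
  have "p \<ge> 1" "p + i = Suc n" "c \<in> colors b p" "xs \<in> colored_compositions (\<not> b) i"
    using ys by (auto simp: eq colored_compositions_def i_def)
  moreover from this have "p = Suc n - i" "i \<le> n" by auto
  ultimately have "(i, c, xs) \<in> ?S" "ys = ?f (i, c, xs)" using eq by auto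
  then show "ys \<in> ?f ` ?S" by blast
qed (auto simp: colored_compositions_def)

lemma finite_colored_compositions: "finite (colored_compositions b n)"
proof (induction n arbitrary: b rule: less_induct)
  case (less n)
  then show ?case
    by (cases n) (auto simp: colored_compositions_0 colored_compositions_Suc finite_colors
        intro!: finite_imageI finite_SigmaI)
qed

lemma card_colored_compositions_Suc:
  "card (colored_compositions b (Suc n)) =
     (\<Sum>i\<le>n. (if b then Suc n - i else 1) * card (colored_compositions (\<not> b) i))"
proof -
  \<comment> \<open>The first part determines \<open>i\<close> because truncated subtraction is
    exact for \<open>i \<le> n\<close>.\<close>
  have "inj_on (\<lambda>(i, c, xs). (Suc n - i, c) # xs)
     (SIGMA i:{..n}. colors b (Suc n - i) \<times> colored_compositions (\<not> b) i)"
    by (auto intro!: inj_onI)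
  then show ?thesis
    unfolding colored_compositions_Suc
    by (simp add: card_image card_SigmaI finite_colors finite_colored_compositions
        card_cartesian_product card_colors)
qed

text \<open>An uncoloured first part gives every summand weight 1, so consecutive counts are partial
  sums differing by their last term.\<close>

lemma card_colored_compositions_False_rec:
  "card (colored_compositions False (Suc (Suc n))) =
     card (colored_compositions False (Suc n)) + card (colored_compositions True (Suc n))"
  by (simp add: card_colored_compositions_Suc[of False])

lemma card_colored_compositions_True_rec:
  "card (colored_compositions True (Suc (Suc n))) =
     card (colored_compositions True (Suc n)) + (\<Sum>i\<le>Suc n. card (colored_compositions False i))"
proof -
  let ?E = "\<lambda>i. card (colored_compositions False i)"
  \<comment> \<open>Raising the total by one raises each weight by one. In the old weights the term
    \<open>i = Suc n\<close> is 0, so that sum stops at \<open>n\<close>.\<close>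
  have "(\<Sum>i\<le>Suc n. (Suc (Suc n) - i) * ?E i) = (\<Sum>i\<le>Suc n. (Suc n - i) * ?E i + ?E i)"
    by (intro sum.cong) (auto simp: Suc_diff_le)
  also have "\<dots> = (\<Sum>i\<le>n. (Suc n - i) * ?E i) + (\<Sum>i\<le>Suc n. ?E i)"
    by (simp add: sum.distrib)
  finally show ?thesis by (simp only: card_colored_compositions_Suc[of True] if_True not_True_eq_False)
qed

text \<open>Both claims are proved together, the second for all \<open>a\<close>, because
  \<open>run_sum_Suc\<close> mixes \<open>run_sum 0\<close> with \<open>run_sum (Suc a)\<close> and
  increases \<open>a\<close>.\<close>

lemma run_sum_eq:
  "run_sum 0 k = card (colored_compositions False (Suc k)) \<and>
   (\<forall>a. run_sum (Suc a) k = card (colored_compositions True (Suc k)) +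
          a * (\<Sum>i\<le>k. card (colored_compositions False i)))"
proof (induction k)
  case 0
  show ?case
    by (simp add: run_sum_0 card_colored_compositions_Suc colored_compositions_0)
next
  case (Suc k)
  let ?E = "\<lambda>i. card (colored_compositions False i)"
  \<comment> \<open>The closed run contributes \<open>Suc a\<close> times \<open>?E (Suc k)\<close>,
    which turns \<open>Suc a\<close> times the sum up to \<open>k\<close> into \<open>Suc a\<close>
    times the sum up to \<open>Suc k\<close>; one copy of this is absorbed by the recurrence for
    flag \<open>True\<close>.\<close>
  have "run_sum (Suc a) (Suc k) =
      card (colored_compositions True (Suc (Suc k))) + a * (\<Sum>i\<le>Suc k. ?E i)" for a
    using Suc by (simp add: run_sum_Suc card_colored_compositions_True_rec algebra_simps)
  moreover have "run_sum 0 (Suc k) = ?E (Suc (Suc k))"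
    using Suc by (simp add: run_sum_Suc card_colored_compositions_False_rec)
  ultimately show ?case by blast
qed

theorem theorem3p4:
  fixes k :: nat
  assumes "k > 0"
  shows "card (even_colored_compositions (k + 1)) =
    (\<Sum>w \<in> binary_strings k. \<Prod>r \<in> one_runs w. card r)"
  using run_sum_eq[of k] by (simp add: even_colored_compositions_eq run_sum_def)

end
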